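(* For every integer $p \ge 0$, the derivative $D^p f_{p+1}$ of the function $f_{p+1}(x) := \|x\|^{p+1}$ on $\mathbb{E}$ is Lipschitz continuous with constant $C_{p,1} = (p+1)!$; that is, $\|D^p f_{p+1}(x_2) - D^p f_{p+1}(x_1)\| \le (p+1)!\,\|x_2-x_1\|$ for all $x_1,x_2 \in \mathbb{E}$.
   Context: $\mathbb{E}$ is a finite-dimensional real vector space with dual space $\mathbb{E}^*$; $\langle s, x\rangle$ denotes the value of $s \in \mathbb{E}^*$ at $x \in \mathbb{E}$. A self-adjoint positive definite operator $B : \mathbb{E} \to \mathbb{E}^*$ is fixed, and $\|x\| := \langle Bx, x\rangle^{1/2}$. $D^p f$ denotes the $p$-th derivative of $f$ (with $D^0 f = f$); $D^p f(x)$ is a symmetric $p$-multilinear form on $\mathbb{E}$ (for $0 \le p < q$ the function $x \mapsto \|x\|^q$ is $p$ times differentiable on $\mathbb{E}$). The norm of a $p$-multilinear form $L$ is $\|L\| := \max_{\|h_1\|=\dots=\|h_p\|=1} |L[h_1,\dots,h_p]|$ (the absolute value when $p=0$). $C_{p,\nu}$ denotes $\prod_{i=1}^p(\nu+i)$ if $p$ is even and $2^{1-\nu}\prod_{i=1}^p(\nu+i)$ if $p$ is odd (empty products equal $1$). *)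

theory Defs
  imports "HOL-Analysis.Analysis"
begin

text \<open>The space is a type of class \<open>euclidean_space\<close>. Its class inner product and norm are
  unrelated to the operator \<open>B\<close>; they only supply the usual topology of a finite-dimensional
  space, with respect to which derivatives are taken. The dual is \<open>'a \<Rightarrow>\<^sub>L real\<close>,
  which in finite dimension contains all linear functionals.\<close>

definition self_adjoint_op :: "('a::euclidean_space \<Rightarrow> 'a \<Rightarrow>\<^sub>L real) \<Rightarrow> bool" where
  "self_adjoint_op B \<longleftrightarrow> (\<forall>x y. blinfun_apply (B x) y = blinfun_apply (B y) x)"

definition positive_definite_op :: "('a::euclidean_space \<Rightarrow> 'a \<Rightarrow>\<^sub>L real) \<Rightarrow> bool" where
  "positive_definite_op B \<longleftrightarrow> (\<forall>x. x \<noteq> 0 \<longrightarrow> 0 < blinfun_apply (B x) x)"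

definition op_norm :: "('a::euclidean_space \<Rightarrow> 'a \<Rightarrow>\<^sub>L real) \<Rightarrow> 'a \<Rightarrow> real" where
  "op_norm B x = sqrt (blinfun_apply (B x) x)"

text \<open>A \<open>p\<close>-linear form is represented by a function on argument lists, of which only the
  values at lists of length \<open>p\<close> matter. \<open>nth_derivative p f x [h\<^sub>1, \<dots>, h\<^sub>p]\<close> is
  \<open>D\<^sup>p f(x)[h\<^sub>1, \<dots>, h\<^sub>p]\<close>: the derivative at \<open>x\<close> in the direction \<open>h\<^sub>1\<close> of
  \<open>y \<mapsto> D\<^sup>p\<^sup>-\<^sup>1 f(y)[h\<^sub>2, \<dots>, h\<^sub>p]\<close>.\<close>

primrec nth_derivative ::
    "nat \<Rightarrow> ('a::euclidean_space \<Rightarrow> real) \<Rightarrow> 'a \<Rightarrow> 'a list \<Rightarrow> real" where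
  "nth_derivative 0 f = (\<lambda>x hs. f x)"
| "nth_derivative (Suc p) f =
     (\<lambda>x hs. frechet_derivative (\<lambda>y. nth_derivative p f y (tl hs)) (at x) (hd hs))"

text \<open>The space of \<open>k\<close>-linear forms is finite-dimensional, so Frechet differentiability of the
  form-valued map \<open>D\<^sup>k f\<close> is Frechet differentiability of all its evaluations at fixed
  arguments. Under this condition \<open>nth_derivative p f x\<close> is a genuine \<open>p\<close>-linear form.\<close>

definition times_differentiable :: "nat \<Rightarrow> ('a::euclidean_space \<Rightarrow> real) \<Rightarrow> bool" where
  "times_differentiable p f \<longleftrightarrow>
     (\<forall>k<p. \<forall>x hs. length hs = k \<longrightarrow> (\<lambda>y. nth_derivative k f y hs) differentiable (at x))"

text \<open>For multilinear \<open>L\<close> the supremum is a maximum, by compactness of the unit sphere of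
  \<open>op_norm B\<close>. For \<open>p = 0\<close> it is \<open>\<bar>L []\<bar>\<close>.\<close>

definition form_norm ::
    "('a::euclidean_space \<Rightarrow> 'a \<Rightarrow>\<^sub>L real) \<Rightarrow> nat \<Rightarrow> ('a list \<Rightarrow> real) \<Rightarrow> real" where
  "form_norm B p L = (SUP hs\<in>{hs. length hs = p \<and> (\<forall>h\<in>set hs. op_norm B h = 1)}. \<bar>L hs\<bar>)"

definition lip_const :: "nat \<Rightarrow> real \<Rightarrow> real" where
  "lip_const p \<nu> =
     (if even p then (\<Prod>i=1..p. \<nu> + real i)
      else 2 powr (1 - \<nu>) * (\<Prod>i=1..p. \<nu> + real i))"

end

theory Submission imports Defs "HOL-Probability.Probability" begin

text \<open>Write \<open>q = p + 1\<close>. The idea is to represent \<open>\<parallel>x\<parallel>\<^sup>q\<close> as a mean of powers of linear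
  functionals: for a random functional \<open>L\<close> with centred Gaussian distribution and covariance \<open>B\<close>,
  the variable \<open>L x\<close> is normal with standard deviation \<open>\<parallel>x\<parallel>\<close>, so \<open>E \<bar>L x\<bar>\<^sup>q\<close> is a constant
  multiple of \<open>\<parallel>x\<parallel>\<^sup>q\<close>, and rescaling \<open>L\<close> makes the constant \<open>1\<close>
  (\<open>exists_random_functional\<close>).

  This reduces the differentiation of \<open>\<parallel>x\<parallel>\<^sup>q\<close> to that of \<open>\<bar>s\<bar>\<^sup>q\<close> on the real line.
  Differentiating \<open>p\<close> times under the expectation gives
  \[ D^p f(x)[h_1, \dots, h_p] = q!\; E\, \phi(L x)\, L h_1 \cdots L h_p, \]
  where \<open>\<phi>(s)\<close> is \<open>s\<close> or \<open>\<bar>s\<bar>\<close>, depending on the parity of \<open>q\<close>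
  (\<open>nth_derivative_integral_power\<close>). In both cases \<open>\<phi>\<close> is 1-Lipschitz, so with
  \<open>y - x = t u\<close> and \<open>\<parallel>u\<parallel> = 1\<close> the difference of the derivatives at \<open>y\<close> and \<open>x\<close> is at most
  \<open>q! \<bar>t\<bar> E \<bar>L u \<cdot> L h\<^sub>1 \<cdots> L h\<^sub>p\<bar>\<close>. This is the expectation of a product of \<open>q\<close> factors whose
  \<open>q\<close>-th absolute moments are all \<open>1\<close>, so it is at most \<open>1\<close> by Hoelder's inequality, here in the
  form of the inequality between arithmetic and geometric means under the integral
  (\<open>integral_prod_list_le_1\<close>).\<close>

section \<open>Powers of a real variable with a sign\<close>

text \<open>The derivatives of \<open>\<bar>s\<bar>\<^sup>q\<close> are, up to constants, the functions \<open>signed_power (even q) m\<close>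
  with \<open>1 \<le> m \<le> q\<close>: differentiation lowers the exponent, whereas the presence of the factor \<open>sgn s\<close>
  is decided once and for all by the parity of \<open>q\<close>.\<close>

definition signed_power :: "bool \<Rightarrow> nat \<Rightarrow> real \<Rightarrow> real" where
  "signed_power e m s = s ^ m * (if e then 1 else sgn s)"

lemma borel_measurable_signed_power [measurable]: "signed_power e m \<in> borel_measurable borel"
  unfolding signed_power_def by measurable

lemma signed_power_Suc: "signed_power e (Suc m) s = s * signed_power e m s"
  by (simp add: signed_power_def)

lemma abs_signed_power_le: "\<bar>signed_power e m s\<bar> \<le> \<bar>s\<bar> ^ m"
  by (auto simp: signed_power_def abs_mult power_abs abs_sgn_eq)

lemma signed_power_even: "0 < m \<Longrightarrow> signed_power (even m) m s = \<bar>s\<bar> ^ m"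
  by (cases "s = 0") (auto simp: signed_power_def sgn_if power_even_abs)

lemma signed_power_1_Lipschitz: "\<bar>signed_power e 1 s - signed_power e 1 t\<bar> \<le> \<bar>s - t\<bar>"
  by (auto simp: signed_power_def sgn_if)

text \<open>Without the factor \<open>sgn s\<close>, or if \<open>s\<close> and \<open>s + h\<close> lie on the same side of \<open>0\<close>, the
  remainder is \<open>\<plusminus>h\<^sup>2\<close> exactly. If the factor changes between them, it is \<open>\<plusminus>(h\<^sup>2 - 2 (s + h)\<^sup>2)\<close>, and \<open>\<bar>s + h\<bar> \<le> \<bar>h\<bar>\<close>.\<close>

lemma signed_square_Taylor:
  "\<bar>signed_power e 2 (s + h) - signed_power e 2 s - 2 * signed_power e 1 s * h\<bar> \<le> h\<^sup>2"
proof (cases "\<not> e \<and> (0 < s \<and> s + h < 0 \<or> s < 0 \<and> 0 < s + h)")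
  case False
  define \<tau> :: real where "\<tau> = (if e \<or> 0 < s \<or> 0 < s + h then 1 else -1)"
  have "signed_power e 2 (s + h) = (s + h)\<^sup>2 * \<tau>" "signed_power e 2 s = s\<^sup>2 * \<tau>"
      "signed_power e 1 s = s * \<tau>"
    using False by (auto simp: signed_power_def sgn_if \<tau>_def)
  then have "signed_power e 2 (s + h) - signed_power e 2 s - 2 * signed_power e 1 s * h = h\<^sup>2 * \<tau>"
    by (simp add: power2_eq_square algebra_simps)
  then show ?thesis by (simp add: \<tau>_def)
next
  case True
  then have "\<bar>s + h\<bar> \<le> \<bar>h\<bar>" by auto
  then have "(s + h)\<^sup>2 \<le> h\<^sup>2" by (simp add: abs_le_square_iff)
  then have "\<bar>h\<^sup>2 - 2 * (s + h)\<^sup>2\<bar> \<le> h\<^sup>2"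
    using zero_le_power2[of "s + h"] by linarith
  moreover have "\<bar>signed_power e 2 (s + h) - signed_power e 2 s - 2 * signed_power e 1 s * h\<bar>
      = \<bar>h\<^sup>2 - 2 * (s + h)\<^sup>2\<bar>"
    using True by (auto simp: signed_power_def power2_eq_square algebra_simps abs_minus_commute)
  ultimately show ?thesis by simp
qed

text \<open>A first-order Taylor estimate that is quadratic in \<open>h\<close> with only polynomial growth in \<open>s\<close>;
  this is what survives integration against a random variable with finite moments. The remainders
  satisfy the recursion \<open>R\<^sub>m\<^sub>+\<^sub>1 = (s + h) R\<^sub>m + m h\<^sup>2 \<phi>\<^sub>m\<^sub>-\<^sub>1(s)\<close> with \<open>\<phi>\<^sub>m\<close> the signed power of
  exponent \<open>m\<close>, so the estimate follows from the quadratic case by algebra alone.\<close>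

lemma signed_power_Taylor:
  "\<bar>signed_power e (m + 2) (s + h) - signed_power e (m + 2) s
      - real (m + 2) * signed_power e (m + 1) s * h\<bar>
    \<le> (real (m + 2))\<^sup>2 * h\<^sup>2 * (\<bar>s\<bar> + \<bar>h\<bar>) ^ m"
proof (induction m)
  case 0
  then show ?case
    using signed_square_Taylor[of e s h] zero_le_power2[of h]
    by (simp add: numeral_2_eq_2)
next
  case (Suc m)
  define R where "R = signed_power e (m + 2) (s + h) - signed_power e (m + 2) s
      - real (m + 2) * signed_power e (m + 1) s * h"
  define K where "K = h\<^sup>2 * (\<bar>s\<bar> + \<bar>h\<bar>) ^ Suc m"
  have "signed_power e (Suc m + 2) (s + h) - signed_power e (Suc m + 2) s
      - real (Suc m + 2) * signed_power e (Suc m + 1) s * h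
      = (s + h) * R + real (m + 2) * h\<^sup>2 * signed_power e (m + 1) s"
    by (simp add: R_def signed_power_Suc algebra_simps power2_eq_square)
  moreover have "\<bar>(s + h) * R\<bar> \<le> (real (m + 2))\<^sup>2 * K"
  proof -
    have "\<bar>(s + h) * R\<bar> \<le> (\<bar>s\<bar> + \<bar>h\<bar>) * ((real (m + 2))\<^sup>2 * h\<^sup>2 * (\<bar>s\<bar> + \<bar>h\<bar>) ^ m)"
      unfolding abs_mult using Suc.IH by (intro mult_mono) (auto simp: R_def)
    then show ?thesis by (simp add: K_def mult_ac)
  qed
  moreover have "\<bar>real (m + 2) * h\<^sup>2 * signed_power e (m + 1) s\<bar> \<le> real (m + 2) * K"
  proof -
    have "\<bar>signed_power e (m + 1) s\<bar> \<le> (\<bar>s\<bar> + \<bar>h\<bar>) ^ Suc m"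
      using abs_signed_power_le[of e "m + 1" s] power_mono[of "\<bar>s\<bar>" "\<bar>s\<bar> + \<bar>h\<bar>" "Suc m"] by simp
    then have "real (m + 2) * (h\<^sup>2 * \<bar>signed_power e (m + 1) s\<bar>) \<le> real (m + 2) * K"
      unfolding K_def by (intro mult_left_mono) auto
    then show ?thesis by (simp add: abs_mult mult_ac)
  qed
  moreover have "((real (m + 2))\<^sup>2 + real (m + 2)) * K \<le> (real (Suc m + 2))\<^sup>2 * K"
  proof (rule mult_right_mono)
    show "0 \<le> K" by (simp add: K_def)
  qed (simp add: power2_eq_square algebra_simps)
  ultimately show ?case
    by (simp only: K_def[symmetric] mult.assoc distrib_right)
qed

section \<open>Estimates for products\<close>

text \<open>The inequality of arithmetic and geometric means for the numbers \<open>\<bar>l h\<bar>\<^sup>q\<close>, where \<open>q\<close> is the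
  number of factors.\<close>

lemma prod_list_le_mean_power:
  fixes l :: "'a \<Rightarrow> real"
  assumes "hs \<noteq> []"
  shows "\<bar>\<Prod>h\<leftarrow>hs. l h\<bar> \<le> (\<Sum>i<length hs. \<bar>l (hs ! i)\<bar> ^ length hs) / length hs"
proof -
  let ?q = "length hs"
  define P where "P = (\<Prod>i<?q. \<bar>l (hs ! i)\<bar>)"
  have "P \<ge> 0" unfolding P_def by (intro prod_nonneg) auto
  have "(\<Prod>i<?q. \<bar>l (hs ! i)\<bar> ^ ?q) powr (1 / card {..<?q})
      \<le> (\<Sum>i<?q. \<bar>l (hs ! i)\<bar> ^ ?q / card {..<?q})"
    using assms by (intro arith_geom_mean) auto
  moreover have "(\<Prod>i<?q. \<bar>l (hs ! i)\<bar> ^ ?q) = P ^ ?q"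
    by (simp add: P_def prod_power_distrib)
  moreover have "(P ^ ?q) powr (1 / ?q) = P"
    using \<open>P \<ge> 0\<close> assms
    by (cases "P = 0") (auto simp: powr_powr powr_realpow[symmetric])
  moreover have "\<bar>\<Prod>h\<leftarrow>hs. l h\<bar> = P"
    by (simp add: P_def prod.list_conv_set_nth abs_prod atLeast0LessThan)
  ultimately show ?thesis by (simp add: sum_divide_distrib)
qed

lemma abs_prod_list_le:
  fixes l :: "'a::real_normed_vector \<Rightarrow> real"
  assumes "\<And>h. \<bar>l h\<bar> \<le> c * norm h"
  shows "\<bar>\<Prod>h\<leftarrow>hs. l h\<bar> \<le> c ^ length hs * (\<Prod>h\<leftarrow>hs. norm h)"
proof (induction hs)
  case (Cons h hs)
  have "\<bar>l h\<bar> * \<bar>\<Prod>h\<leftarrow>hs. l h\<bar> \<le> (c * norm h) * (c ^ length hs * (\<Prod>h\<leftarrow>hs. norm h))"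
    using assms[of h] Cons.IH by (intro mult_mono) (auto intro: order_trans[OF abs_ge_zero])
  then show ?case by (simp add: abs_mult mult_ac)
qed simp

section \<open>Differentiation under the integral of a random linear functional\<close>

text \<open>The random variable \<open>N\<close> bounds the operator norm of \<open>L\<close>. As all its moments are finite,
  every expression that is a polynomial in values of \<open>L\<close>, with or without signs, is integrable.
  The exponent \<open>k = 0\<close> says that the measure is finite, \<open>k = 1\<close> that \<open>N\<close> is measurable.\<close>

locale random_functional =
  fixes M :: "'w measure" and L :: "'w \<Rightarrow> 'a::euclidean_space \<Rightarrow> real" and N :: "'w \<Rightarrow> real"
  assumes linear_L: "linear (L w)"
    and measurable_L [measurable]: "(\<lambda>w. L w x) \<in> borel_measurable M"
    and L_le: "\<bar>L w x\<bar> \<le> N w * norm x"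
    and integrable_N: "integrable M (\<lambda>w. N w ^ k)"
begin

lemma N_nonneg: "0 \<le> N w"
proof -
  obtain b :: 'a where b: "b \<in> Basis" using nonempty_Basis by blast
  show ?thesis using L_le[of w b] b by auto
qed

lemma measurable_prod_list_L [measurable]: "(\<lambda>w. \<Prod>h\<leftarrow>hs. L w h) \<in> borel_measurable M"
  by (induction hs) auto

lemma integrable_dominated:
  assumes "g \<in> borel_measurable M" and "\<And>w. \<bar>g w\<bar> \<le> K * N w ^ k"
  shows "integrable M g"
  by (rule Bochner_Integration.integrable_bound[where f = "\<lambda>w. K * N w ^ k"])
    (use assms in \<open>auto intro: integrable_N order_trans[OF _ abs_ge_self]\<close>)

lemma integrable_monomial: "integrable M (\<lambda>w. signed_power e m (L w x) * (\<Prod>h\<leftarrow>hs. L w h))"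
proof (rule integrable_dominated)
  fix w
  have "\<bar>signed_power e m (L w x)\<bar> \<le> (N w * norm x) ^ m"
    using abs_signed_power_le[of e m "L w x"] L_le[of w x]
    by (meson abs_ge_zero order_trans power_mono)
  then have "\<bar>signed_power e m (L w x) * (\<Prod>h\<leftarrow>hs. L w h)\<bar>
      \<le> (N w * norm x) ^ m * (N w ^ length hs * (\<Prod>h\<leftarrow>hs. norm h))"
    unfolding abs_mult using N_nonneg
    by (intro mult_mono abs_prod_list_le L_le) auto
  then show "\<bar>signed_power e m (L w x) * (\<Prod>h\<leftarrow>hs. L w h)\<bar>
      \<le> (norm x ^ m * (\<Prod>h\<leftarrow>hs. norm h)) * N w ^ (m + length hs)"
    by (simp add: power_mult_distrib power_add mult_ac)
qed measurable

text \<open>The Taylor estimate for signed powers, applied with the increment \<open>L v\<close>, bounds the remainder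
  of the integral by a constant times \<open>(norm v)\<^sup>2\<close> for \<open>norm v < 1\<close>.\<close>

lemma has_derivative_integral_signed_power:
  "((\<lambda>y. \<integral>w. signed_power e (m + 2) (L w y) * (\<Prod>h\<leftarrow>hs. L w h) \<partial>M) has_derivative
    (\<lambda>v. real (m + 2) * (\<integral>w. signed_power e (m + 1) (L w x) * (\<Prod>h\<leftarrow>v # hs. L w h) \<partial>M))) (at x)"
    (is "(?G has_derivative ?D) (at x)")
proof (rule has_derivativeI_sandwich)
  define C where "C = (real (m + 2))\<^sup>2 * (norm x + 1) ^ m * (\<Prod>h\<leftarrow>hs. norm h)"
  define I where "I = (\<integral>w. N w ^ (m + 2 + length hs) \<partial>M)"
  show "bounded_linear ?D"
  proof (rule linear_conv_bounded_linear[THEN iffD1], rule linearI)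
    fix u v :: 'a and c :: real
    note int = integrable_monomial[where hs = "_ # hs"]
    show "?D (u + v) = ?D u + ?D v"
      unfolding distrib_left[symmetric] Bochner_Integration.integral_add[OF int int, symmetric]
      by (simp add: linear_add[OF linear_L] algebra_simps)
    show "?D (c *\<^sub>R v) = c *\<^sub>R ?D v"
      by (simp add: linear_scale[OF linear_L] mult.left_commute[of _ c] mult.assoc)
  qed
  show "(0::real) < 1" by simp
  show "((\<lambda>y. C * I * norm (y - x)) \<longlongrightarrow> 0) (at x)"
    by (auto intro!: tendsto_eq_intros)
  fix y assume "y \<noteq> x" "dist y x < 1"
  define v where "v = y - x"
  have v: "norm v < 1" "v \<noteq> 0" and y: "y = x + v"
    using \<open>y \<noteq> x\<close> \<open>dist y x < 1\<close> by (auto simp: v_def dist_norm)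
  define R where "R w = signed_power e (m + 2) (L w x + L w v) - signed_power e (m + 2) (L w x)
      - real (m + 2) * signed_power e (m + 1) (L w x) * L w v" for w
  define P where "P w = (\<Prod>h\<leftarrow>hs. L w h)" for w
  have diff: "?G y - ?G x - ?D v = (\<integral>w. R w * P w \<partial>M)"
  proof -
    note int = integrable_monomial[where hs = hs] integrable_monomial[where hs = "v # hs"]
    have "?G y - ?G x - ?D v = (\<integral>w. signed_power e (m + 2) (L w y) * (\<Prod>h\<leftarrow>hs. L w h)
        - signed_power e (m + 2) (L w x) * (\<Prod>h\<leftarrow>hs. L w h)
        - real (m + 2) * (signed_power e (m + 1) (L w x) * (\<Prod>h\<leftarrow>v # hs. L w h)) \<partial>M)"
      by (subst Bochner_Integration.integral_diff
          Bochner_Integration.integral_mult_right_zero[symmetric]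
        | intro Bochner_Integration.integrable_diff integrable_mult_right int refl)+
    then show ?thesis
      by (simp add: R_def P_def y linear_add[OF linear_L] algebra_simps)
  qed
  have RP: "\<bar>R w * P w\<bar> \<le> (C * (norm v)\<^sup>2) * N w ^ (m + 2 + length hs)" for w
  proof -
    note Lv = L_le[of w v]
    also have "N w * norm v \<le> N w * 1" using v N_nonneg[of w] by (intro mult_left_mono) auto
    finally have sum: "\<bar>L w x\<bar> + \<bar>L w v\<bar> \<le> N w * (norm x + 1)"
      using L_le[of w x] by (simp add: algebra_simps)
    have sq: "(L w v)\<^sup>2 \<le> (N w * norm v)\<^sup>2"
      using power_mono[OF Lv, of 2] by simp
    have "(L w v)\<^sup>2 * (\<bar>L w x\<bar> + \<bar>L w v\<bar>) ^ m
        \<le> (N w * norm v)\<^sup>2 * (N w * (norm x + 1)) ^ m"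
      by (rule mult_mono[OF sq power_mono[OF sum]]) auto
    then have "(real (m + 2))\<^sup>2 * ((L w v)\<^sup>2 * (\<bar>L w x\<bar> + \<bar>L w v\<bar>) ^ m)
        \<le> (real (m + 2))\<^sup>2 * ((N w * norm v)\<^sup>2 * (N w * (norm x + 1)) ^ m)"
      by (intro mult_left_mono) auto
    then have "\<bar>R w\<bar> \<le> (real (m + 2))\<^sup>2 * ((N w * norm v)\<^sup>2 * (N w * (norm x + 1)) ^ m)"
      using signed_power_Taylor[of e m "L w x" "L w v"] unfolding R_def mult.assoc
      by (rule order_trans[rotated])
    then have "\<bar>R w * P w\<bar> \<le> (real (m + 2))\<^sup>2 * ((N w * norm v)\<^sup>2 * (N w * (norm x + 1)) ^ m)
        * (N w ^ length hs * (\<Prod>h\<leftarrow>hs. norm h))"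
      unfolding abs_mult P_def using N_nonneg
      by (intro mult_mono abs_prod_list_le L_le) auto
    then show ?thesis
      by (simp add: C_def power_mult_distrib power_add power2_eq_square mult_ac)
  qed
  have "\<bar>?G y - ?G x - ?D v\<bar> \<le> (\<integral>w. (C * (norm v)\<^sup>2) * N w ^ (m + 2 + length hs) \<partial>M)"
  proof -
    have "integrable M (\<lambda>w. R w * P w)"
      by (rule integrable_dominated[OF _ RP]) (unfold R_def P_def, measurable)
    then have "\<bar>\<integral>w. R w * P w \<partial>M\<bar> \<le> (\<integral>w. (C * (norm v)\<^sup>2) * N w ^ (m + 2 + length hs) \<partial>M)"
      by (intro order_trans[OF integral_abs_bound] integral_mono integrable_mult_right integrable_N RP)
        auto
    then show ?thesis using diff by simp
  qed
  then have "\<bar>?G y - ?G x - ?D v\<bar> \<le> C * I * norm v * norm v"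
    unfolding integral_mult_right_zero I_def[symmetric] by (simp only: power2_eq_square mult_ac)
  then show "norm (?G y - ?G x - ?D (y - x)) / norm (y - x) \<le> C * I * norm (y - x)"
    using v by (simp add: v_def divide_le_eq)
qed

text \<open>Each differentiation in a direction \<open>h\<close> lowers the exponent by one and brings down the factor
  \<open>L h\<close>. The restriction \<open>k < q\<close> keeps the exponent \<open>q - k\<close> positive: the last function reached is
  \<open>s\<close> or \<open>\<bar>s\<bar>\<close>, and \<open>\<bar>s\<bar>\<close> has no derivative at \<open>0\<close>.\<close>

lemma nth_derivative_integral_power:
  fixes q :: nat
  defines "f \<equiv> \<lambda>x. \<integral>w. \<bar>L w x\<bar> ^ q \<partial>M"
  assumes "k < q" and "length hs = k"
  shows "nth_derivative k f x hs = fact q / fact (q - k) *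
    (\<integral>w. signed_power (even q) (q - k) (L w x) * (\<Prod>h\<leftarrow>hs. L w h) \<partial>M)"
  using assms(2,3)
proof (induction k arbitrary: x hs)
  case 0
  then show ?case by (simp add: f_def signed_power_even)
next
  case (Suc k)
  then obtain h hs' where hs: "hs = h # hs'" "length hs' = k" by (cases hs) auto
  obtain m where m: "q = k + (m + 2)"
    using \<open>Suc k < q\<close> that[of "q - k - 2"] by simp
  let ?c = "fact q / fact (q - k) :: real"
  have "(\<lambda>y. nth_derivative k f y hs') =
      (\<lambda>y. ?c * (\<integral>w. signed_power (even q) (m + 2) (L w y) * (\<Prod>h\<leftarrow>hs'. L w h) \<partial>M))"
    using Suc.IH[OF _ hs(2)] m by simp
  then have "((\<lambda>y. nth_derivative k f y hs') has_derivative
      (\<lambda>v. ?c * (real (m + 2) *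
        (\<integral>w. signed_power (even q) (m + 1) (L w x) * (\<Prod>h\<leftarrow>v # hs'. L w h) \<partial>M)))) (at x)"
    by (simp only:) (intro has_derivative_mult_right has_derivative_integral_signed_power)
  from frechet_derivative_at[OF this, symmetric]
  have "nth_derivative (Suc k) f x hs = ?c * real (m + 2) *
      (\<integral>w. signed_power (even q) (m + 1) (L w x) * (\<Prod>h\<leftarrow>hs. L w h) \<partial>M)"
    using hs(1) by (simp only: nth_derivative.simps list.sel mult.assoc)
  moreover have "?c * real (m + 2) = fact q / fact (q - Suc k)"
  proof -
    have "(fact (q - k) :: real) = real (m + 2) * fact (m + 1)" and "q - Suc k = m + 1"
      using m by simp_all
    then show ?thesis by (simp only: divide_divide_eq_left) simp
  qed
  ultimately show ?case using m by simp
qed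

lemma times_differentiable_integral_power:
  "times_differentiable p (\<lambda>x. \<integral>w. \<bar>L w x\<bar> ^ (p + 1) \<partial>M)"
  unfolding times_differentiable_def
proof (intro allI impI)
  fix k x and hs :: "'a list"
  assume "k < p" "length hs = k"
  then have "p + 1 - k = (p - k - 1) + 2" by simp
  then show "(\<lambda>y. nth_derivative k (\<lambda>x. \<integral>w. \<bar>L w x\<bar> ^ (p + 1) \<partial>M) y hs) differentiable (at x)"
    using \<open>k < p\<close> \<open>length hs = k\<close>
    by (auto simp only: nth_derivative_integral_power less_SucI Suc_eq_plus1[symmetric] differentiable_def
       intro!: has_derivative_mult_right has_derivative_integral_signed_power)
qed

text \<open>Hoelder's inequality for factors of norm \<open>1\<close> in \<open>L\<^sup>q\<close>. For such factors it is just the mean of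
  the pointwise inequality between the geometric and the arithmetic mean.\<close>

lemma integral_prod_list_le_1:
  assumes "hs \<noteq> []" and "\<And>h. h \<in> set hs \<Longrightarrow> (\<integral>w. \<bar>L w h\<bar> ^ length hs \<partial>M) = 1"
  shows "(\<integral>w. \<bar>\<Prod>h\<leftarrow>hs. L w h\<bar> \<partial>M) \<le> 1"
proof -
  let ?q = "length hs"
  have int: "integrable M (\<lambda>w. \<bar>L w x\<bar> ^ ?q)" for x
    using integrable_monomial[of "even ?q" ?q x "[]"] assms(1) by (simp add: signed_power_even)
  have "(\<integral>w. \<bar>\<Prod>h\<leftarrow>hs. L w h\<bar> \<partial>M) \<le> (\<integral>w. (\<Sum>i<?q. \<bar>L w (hs ! i)\<bar> ^ ?q) / ?q \<partial>M)"
    using integrable_monomial[of True 0 0 hs]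
    by (intro integral_mono prod_list_le_mean_power assms(1) integrable_divide_zero
       Bochner_Integration.integrable_sum int integrable_abs) (auto simp: signed_power_def)
  also have "\<dots> = (\<Sum>i<?q. \<integral>w. \<bar>L w (hs ! i)\<bar> ^ ?q \<partial>M) / ?q"
    by (simp add: int)
  also have "\<dots> = 1" using assms by simp
  finally show ?thesis .
qed

text \<open>The increment of \<open>L\<close> from \<open>x\<close> to \<open>y\<close> is \<open>t L u\<close>. It joins the factors \<open>L h\<close> as one more factor
  of norm \<open>1\<close>, so that their number is exactly the exponent \<open>p + 1\<close> that Hoelder's inequality
  requires.\<close>

lemma nth_derivative_integral_power_Lipschitz:
  fixes p :: nat
  defines "f \<equiv> \<lambda>x. \<integral>w. \<bar>L w x\<bar> ^ (p + 1) \<partial>M"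
  assumes "length hs = p" and unit: "\<And>h. h \<in> set hs \<Longrightarrow> f h = 1"
    and u: "f u = 1" and xy: "y - x = t *\<^sub>R u"
  shows "\<bar>nth_derivative p f y hs - nth_derivative p f x hs\<bar> \<le> fact (p + 1) * \<bar>t\<bar>"
proof -
  let ?s = "signed_power (even (p + 1)) 1"
  have "nth_derivative p f y hs - nth_derivative p f x hs =
     fact (p + 1) * (\<integral>w. ?s (L w y) * (\<Prod>h\<leftarrow>hs. L w h) - ?s (L w x) * (\<Prod>h\<leftarrow>hs. L w h) \<partial>M)"
    using assms(2) by (simp add: f_def nth_derivative_integral_power[of p "Suc p", simplified]
        right_diff_distrib integrable_monomial[where m = 1, simplified])
  moreover have "\<bar>\<integral>w. ?s (L w y) * (\<Prod>h\<leftarrow>hs. L w h) - ?s (L w x) * (\<Prod>h\<leftarrow>hs. L w h) \<partial>M\<bar>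
      \<le> (\<integral>w. \<bar>t\<bar> * \<bar>\<Prod>h\<leftarrow>u # hs. L w h\<bar> \<partial>M)"
  proof (intro order_trans[OF integral_abs_bound] integral_mono)
    show "integrable M (\<lambda>w. \<bar>t\<bar> * \<bar>\<Prod>h\<leftarrow>u # hs. L w h\<bar>)"
      using integrable_monomial[of True 0 0 "u # hs"]
      by (intro integrable_mult_right integrable_abs) (auto simp: signed_power_def)
    show "integrable M (\<lambda>w. \<bar>?s (L w y) * (\<Prod>h\<leftarrow>hs. L w h) - ?s (L w x) * (\<Prod>h\<leftarrow>hs. L w h)\<bar>)"
      by (intro integrable_abs Bochner_Integration.integrable_diff integrable_monomial)
    fix w
    have "\<bar>?s (L w y) - ?s (L w x)\<bar> \<le> \<bar>L w y - L w x\<bar>"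
      by (rule signed_power_1_Lipschitz)
    also have "L w y - L w x = t * L w u"
      by (simp add: linear_diff[OF linear_L, symmetric] linear_scale[OF linear_L] xy)
    finally have "\<bar>?s (L w y) - ?s (L w x)\<bar> * \<bar>\<Prod>h\<leftarrow>hs. L w h\<bar> \<le> \<bar>t * L w u\<bar> * \<bar>\<Prod>h\<leftarrow>hs. L w h\<bar>"
      by (intro mult_right_mono) auto
    then show "\<bar>?s (L w y) * (\<Prod>h\<leftarrow>hs. L w h) - ?s (L w x) * (\<Prod>h\<leftarrow>hs. L w h)\<bar>
        \<le> \<bar>t\<bar> * \<bar>\<Prod>h\<leftarrow>u # hs. L w h\<bar>"
      by (simp only: left_diff_distrib[symmetric] abs_mult list.map prod_list.Cons mult.assoc)
  qed
  moreover have "(\<integral>w. \<bar>t\<bar> * \<bar>\<Prod>h\<leftarrow>u # hs. L w h\<bar> \<partial>M) \<le> \<bar>t\<bar> * 1"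
    unfolding integral_mult_right_zero
    using unit u assms(2) by (intro mult_left_mono integral_prod_list_le_1) (auto simp: f_def)
  ultimately show ?thesis
    by (simp add: abs_mult mult_left_mono)
qed

end

section \<open>Moments of Gaussian linear combinations\<close>

lemma (in prob_space) normal_abs_moment:
  assumes "distributed M lborel X (normal_density 0 \<sigma>)" and "0 < \<sigma>"
  shows "(\<integral>w. \<bar>X w\<bar> ^ q \<partial>M) = \<sigma> ^ q * (\<integral>x. std_normal_density x * \<bar>x\<bar> ^ q \<partial>lborel)"
proof -
  have "distributed M lborel (\<lambda>w. X w / \<sigma>) std_normal_density"
    using assms normal_standard_normal_convert[of \<sigma> X 0] by simp
  then have "(\<integral>x. std_normal_density x * \<bar>x\<bar> ^ q \<partial>lborel) = (\<integral>w. \<bar>X w / \<sigma>\<bar> ^ q \<partial>M)"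
    by (rule distributed_integral) auto
  also have "\<dots> = (\<integral>w. \<bar>X w\<bar> ^ q \<partial>M) / \<sigma> ^ q"
    using assms(2) by (simp add: power_divide)
  finally show ?thesis using assms(2) by simp
qed

lemma std_normal_abs_moment_pos: "0 < (\<integral>x. std_normal_density x * \<bar>x\<bar> ^ q \<partial>lborel)"
proof (cases "even q")
  case True
  then obtain k where "q = 2 * k" by (elim evenE)
  then show ?thesis
    using integral_std_normal_moment_even[of k] by (simp add: power_even_abs)
next
  case False
  then obtain k where "q = 2 * k + 1" by (elim oddE)
  then show ?thesis
    using integral_std_normal_moment_abs_odd[of k] by (simp del: power_Suc)
qed

abbreviation std_gaussian :: "'i set \<Rightarrow> ('i \<Rightarrow> real) measure" where
  "std_gaussian S \<equiv> (\<Pi>\<^sub>M i\<in>S. std_normal_distribution)"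

lemma prob_space_std_gaussian: "prob_space (std_gaussian S)"
  by (intro prob_space_PiM prob_space_normal_density) simp

lemma distributed_std_gaussian_component:
  assumes "i \<in> S"
  shows "distributed (std_gaussian S) lborel (\<lambda>w. w i) std_normal_density"
proof -
  let ?D = "std_normal_distribution"
  have "distr (std_gaussian S) ?D (\<lambda>w. w i) = ?D"
    using assms by (intro distr_PiM_component prob_space_normal_density) auto
  then have "distr (std_gaussian S) lborel (\<lambda>w. w i) = ?D"
    by (metis (no_types, lifting) distr_cong sets_density sets_lborel)
  moreover have "(\<lambda>w. w i) \<in> measurable (std_gaussian S) lborel"
    using measurable_component_singleton[OF assms, of "\<lambda>_. ?D"] by simp
  ultimately show ?thesis by (simp add: distributed_def)
qed

lemma indep_vars_std_gaussian:
  assumes "S \<noteq> {}"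
  shows "prob_space.indep_vars (std_gaussian S) (\<lambda>_. borel) (\<lambda>i w. w i) S"
proof -
  let ?D = "std_normal_distribution"
  interpret prob_space "std_gaussian S" by (rule prob_space_std_gaussian)
  have meas: "(\<lambda>w. w i) \<in> measurable (std_gaussian S) ?D" if "i \<in> S" for i
    using measurable_component_singleton[OF that, of "\<lambda>_. ?D"] by simp
  have "distr (std_gaussian S) (std_gaussian S) (\<lambda>w. \<lambda>i\<in>S. w i) = distr (std_gaussian S) (std_gaussian S) (\<lambda>w. w)"
    by (intro distr_cong) (auto simp: space_PiM)
  also have "\<dots> = (\<Pi>\<^sub>M i\<in>S. distr (std_gaussian S) ?D (\<lambda>w. w i))"
    by (simp only: distr_id, intro PiM_cong refl sym[OF distr_PiM_component] prob_space_normal_density) auto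
  finally have "indep_vars (\<lambda>_. ?D) (\<lambda>i w. w i) S"
    using meas assms by (subst indep_vars_iff_distr_eq_PiM') auto
  then show ?thesis
    using indep_vars_compose2[of "\<lambda>_. ?D" "\<lambda>i w. w i" S "\<lambda>_ x. x" "\<lambda>_. borel"] by simp
qed

text \<open>A linear combination of independent standard normal variables is normal, and its variance is
  the sum of the squared coefficients. Hence its absolute moments are those of a standard normal
  variable times powers of the Euclidean norm of the coefficient vector.\<close>

lemma std_gaussian_linear_moment:
  assumes "finite S" and "0 < q"
  shows "(\<integral>w. \<bar>\<Sum>i\<in>S. c i * w i\<bar> ^ q \<partial>std_gaussian S)
    = sqrt (\<Sum>i\<in>S. (c i)\<^sup>2) ^ q * (\<integral>x. std_normal_density x * \<bar>x\<bar> ^ q \<partial>lborel)"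
proof -
  interpret prob_space "std_gaussian S" by (rule prob_space_std_gaussian)
  \<comment> \<open>Normal densities need a positive deviation, so the terms with coefficient \<open>0\<close> are removed.\<close>
  define J where "J = {i \<in> S. c i \<noteq> 0}"
  have J: "finite J" "J \<subseteq> S" "\<And>i. i \<in> J \<Longrightarrow> c i \<noteq> 0" using assms(1) by (auto simp: J_def)
  have sums: "(\<Sum>i\<in>S. c i * w i) = (\<Sum>i\<in>J. c i * w i)" "(\<Sum>i\<in>S. (c i)\<^sup>2) = (\<Sum>i\<in>J. (c i)\<^sup>2)" for w
    using assms(1) by (auto intro!: sum.mono_neutral_right simp: J_def)
  show ?thesis
  proof (cases "J = {}")
    case True
    then show ?thesis using assms(2) by (simp add: sums)
  next
    case False
    then have "S \<noteq> {}" using J(2) by auto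
    have "indep_vars (\<lambda>_. borel) (\<lambda>i w. c i * w i) J"
      using indep_vars_compose2[OF indep_vars_subset[OF indep_vars_std_gaussian[OF \<open>S \<noteq> {}\<close>] J(2)],
          of "\<lambda>i x. c i * x" "\<lambda>_. borel"] by simp
    moreover have "distributed (std_gaussian S) lborel (\<lambda>w. c i * w i) (normal_density 0 \<bar>c i\<bar>)"
      if "i \<in> J" for i
      using normal_density_affine[OF distributed_std_gaussian_component, of i "c i" 0] J that by auto
    ultimately have "distributed (std_gaussian S) lborel (\<lambda>w. \<Sum>i\<in>J. c i * w i)
        (normal_density (\<Sum>i\<in>J. 0) (sqrt (\<Sum>i\<in>J. \<bar>c i\<bar>\<^sup>2)))"
      using J False by (intro sum_indep_normal) auto
    moreover have "0 < (\<Sum>i\<in>J. (c i)\<^sup>2)"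
      using J False by (intro sum_pos) auto
    ultimately show ?thesis
      unfolding sums by (intro normal_abs_moment) auto
  qed
qed

text \<open>The summand \<open>1\<close> on the right covers the case of empty \<open>S\<close> and \<open>k = 0\<close>.\<close>

lemma sum_power_le_card:
  fixes a :: "'i \<Rightarrow> real"
  assumes "finite S" and "\<And>i. i \<in> S \<Longrightarrow> 0 \<le> a i"
  shows "(\<Sum>i\<in>S. a i) ^ k \<le> 1 + real (card S) ^ k * (\<Sum>i\<in>S. a i ^ k)"
proof (cases "S = {}")
  case True
  then show ?thesis by (cases k) auto
next
  case False
  define m where "m = Max (a ` S)"
  have m: "m \<in> a ` S" "\<And>i. i \<in> S \<Longrightarrow> a i \<le> m"
    using assms(1) False by (auto simp: m_def)
  then have "(\<Sum>i\<in>S. a i) \<le> real (card S) * m"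
    using sum_bounded_above[of S a m] by simp
  then have "(\<Sum>i\<in>S. a i) ^ k \<le> (real (card S) * m) ^ k"
    using assms(2) by (intro power_mono sum_nonneg) auto
  also have "m ^ k \<le> (\<Sum>i\<in>S. a i ^ k)"
    using m(1) assms by (auto intro!: member_le_sum[of _ S "\<lambda>i. a i ^ k"])
  then have "(real (card S) * m) ^ k \<le> 1 + real (card S) ^ k * (\<Sum>i\<in>S. a i ^ k)"
    by (auto simp: power_mult_distrib intro!: add_increasing mult_left_mono)
  finally show ?thesis .
qed

lemma integrable_std_gaussian_l1_power:
  assumes "finite S"
  shows "integrable (std_gaussian S) (\<lambda>w. (\<Sum>i\<in>S. \<bar>w i\<bar>) ^ k)"
proof -
  interpret prob_space "std_gaussian S" by (rule prob_space_std_gaussian)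
  have comp: "integrable (std_gaussian S) (\<lambda>w. \<bar>w i\<bar> ^ k)" if "i \<in> S" for i
    using distributed_integrable[OF distributed_std_gaussian_component[OF that], of "\<lambda>x. \<bar>x\<bar> ^ k"]
      integrable_std_normal_moment_abs[of k] by simp
  have [measurable]: "(\<lambda>w. w i) \<in> borel_measurable (std_gaussian S)" if "i \<in> S" for i
    using distributed_std_gaussian_component[OF that] by (simp add: distributed_def)
  show ?thesis
  proof (rule Bochner_Integration.integrable_bound)
    show "integrable (std_gaussian S) (\<lambda>w. 1 + real (card S) ^ k * (\<Sum>i\<in>S. \<bar>w i\<bar> ^ k))"
      by (intro Bochner_Integration.integrable_add integrable_mult_right
          Bochner_Integration.integrable_sum comp) auto
    show "AE w in std_gaussian S. norm ((\<Sum>i\<in>S. \<bar>w i\<bar>) ^ k)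
        \<le> norm (1 + real (card S) ^ k * (\<Sum>i\<in>S. \<bar>w i\<bar> ^ k))"
    proof (rule AE_I2)
      fix w :: "'a \<Rightarrow> real"
      have "0 \<le> (\<Sum>i\<in>S. \<bar>w i\<bar>) ^ k" by (intro zero_le_power sum_nonneg) auto
      with sum_power_le_card[OF assms, of "\<lambda>i. \<bar>w i\<bar>" k]
      show "norm ((\<Sum>i\<in>S. \<bar>w i\<bar>) ^ k) \<le> norm (1 + real (card S) ^ k * (\<Sum>i\<in>S. \<bar>w i\<bar> ^ k))"
        by simp
    qed
  qed measurable
qed

section \<open>The norm as a mean of absolute values of functionals\<close>

text \<open>The set \<open>E\<close> is an orthonormal basis for the inner product given by \<open>B\<close>, obtained as an
  orthonormal set of maximal size: if some vector differed from its orthogonal projection to the span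
  of \<open>E\<close>, the normalized difference could be added to \<open>E\<close>.\<close>

lemma exists_orthonormal_decomposition:
  fixes B :: "'a::euclidean_space \<Rightarrow> 'a \<Rightarrow>\<^sub>L real"
  assumes "linear B" and "self_adjoint_op B" and "positive_definite_op B"
  obtains E where "finite E" and "\<And>x. blinfun_apply (B x) x = (\<Sum>e\<in>E. (blinfun_apply (B e) x)\<^sup>2)"
proof -
  define b where "b x y = blinfun_apply (B x) y" for x y
  have sym: "b x y = b y x" for x y
    using assms(2) by (auto simp: b_def self_adjoint_op_def)
  have pos: "0 < b x x" if "x \<noteq> 0" for x
    using assms(3) that by (auto simp: b_def positive_definite_op_def)
  have lin_r: "linear (b x)" for x
    unfolding b_def by (rule bounded_linear.linear[OF blinfun.bounded_linear_right])
  have lin_l: "linear (\<lambda>x. b x y)" for y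
    using lin_r[of y] by (simp add: sym[of _ y])
  define orth where "orth E \<longleftrightarrow> finite E \<and> (\<forall>e\<in>E. \<forall>e'\<in>E. b e e' = (if e = e' then 1 else 0))"
    for E
  have coeff: "b (\<Sum>e\<in>E. u e *\<^sub>R e) e' = u e'" if "orth E" "e' \<in> E" for E u e'
  proof -
    have "b (\<Sum>e\<in>E. u e *\<^sub>R e) e' = (\<Sum>e\<in>E. u e * b e e')"
      by (simp add: linear_sum[OF lin_l] linear_scale[OF lin_l])
    also have "\<dots> = (\<Sum>e\<in>E. if e = e' then u e else 0)"
      using that by (intro sum.cong) (auto simp: orth_def)
    also have "\<dots> = u e'" using that by (simp add: orth_def)
    finally show ?thesis .
  qed
  have "card E \<le> DIM('a)" if "orth E" for E
  proof -
    have "independent E"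
      using that coeff[OF that] linear_0[OF lin_l]
      by (subst independent_explicit_finite_subsets) (metis (no_types, lifting) coeff orth_def subsetD)
    then show ?thesis by (rule independent_bound[THEN conjunct2])
  qed
  moreover have "orth {}" by (simp add: orth_def)
  ultimately obtain E where E: "orth E" and max: "\<And>E'. orth E' \<Longrightarrow> card E' \<le> card E"
    using Lattices_Big.ex_has_greatest_nat[of orth "{}" card "Suc DIM('a)"] less_Suc_eq_le by blast
  have expand: "x = (\<Sum>e\<in>E. b e x *\<^sub>R e)" for x
  proof (rule ccontr)
    define r where "r = x - (\<Sum>e\<in>E. b e x *\<^sub>R e)"
    assume "x \<noteq> (\<Sum>e\<in>E. b e x *\<^sub>R e)"
    then have "0 < b r r" by (intro pos) (simp add: r_def)
    define v where "v = (1 / sqrt (b r r)) *\<^sub>R r"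
    have r_orth: "b r e = 0" if "e \<in> E" for e
      using coeff[OF E that, of "\<lambda>e. b e x"] by (simp add: r_def linear_diff[OF lin_l] sym[of x])
    then have v_orth: "b v e = 0" "b e v = 0" if "e \<in> E" for e
      using that by (simp_all add: v_def linear_scale[OF lin_l] sym[of e])
    have "b v v = 1"
      using \<open>0 < b r r\<close> by (simp add: v_def linear_scale[OF lin_l] linear_scale[OF lin_r])
    then have "v \<notin> E" using v_orth(1) by force
    have "orth (insert v E)"
      using E \<open>b v v = 1\<close> v_orth \<open>v \<notin> E\<close> by (auto simp: orth_def)
    from max[OF this] show False using E \<open>v \<notin> E\<close> by (simp add: orth_def)
  qed
  have "b x x = (\<Sum>e\<in>E. (b e x)\<^sup>2)" for x
  proof -
    have "b x x = b (\<Sum>e\<in>E. b e x *\<^sub>R e) x" using expand[of x] by simp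
    also have "\<dots> = (\<Sum>e\<in>E. (b e x)\<^sup>2)"
      by (simp add: linear_sum[OF lin_l] linear_scale[OF lin_l] power2_eq_square)
    finally show ?thesis .
  qed
  then show thesis using E that by (auto simp: orth_def b_def)
qed

text \<open>With independent standard normal coefficients \<open>w e\<close> at an orthonormal basis \<open>E\<close>, the
  functional \<open>x \<mapsto> \<Sum>e\<in>E. \<langle>B e, x\<rangle> w e\<close> has \<open>q\<close>-th absolute moment \<open>\<mu> \<parallel>x\<parallel>\<^sup>q\<close>, where \<open>\<mu>\<close> is that
  of a standard normal variable. The factor \<open>c\<close> with \<open>c\<^sup>q = 1 / \<mu>\<close> removes \<open>\<mu>\<close>.\<close>

lemma exists_random_functional:
  fixes B :: "'a::euclidean_space \<Rightarrow> 'a \<Rightarrow>\<^sub>L real"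
  assumes "linear B" and "self_adjoint_op B" and "positive_definite_op B" and "0 < q"
  obtains M :: "('a \<Rightarrow> real) measure" and L :: "('a \<Rightarrow> real) \<Rightarrow> 'a \<Rightarrow> real" and N
  where "random_functional M L N"
    and "\<And>x. op_norm B x ^ q = (\<integral>w. \<bar>L w x\<bar> ^ q \<partial>M)"
proof -
  obtain E where E: "finite E"
      "\<And>x. blinfun_apply (B x) x = (\<Sum>e\<in>E. (blinfun_apply (B e) x)\<^sup>2)"
    using exists_orthonormal_decomposition[OF assms(1-3)] by blast
  define \<mu> where "\<mu> = (\<integral>x. std_normal_density x * \<bar>x\<bar> ^ q \<partial>lborel)"
  have "0 < \<mu>" unfolding \<mu>_def by (rule std_normal_abs_moment_pos)
  define c where "c = root q (1 / \<mu>)"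
  have c: "0 < c" "c ^ q = 1 / \<mu>"
    using \<open>0 < \<mu>\<close> assms(4) by (simp_all add: c_def real_root_gt_zero)
  define L where "L w x = c * (\<Sum>e\<in>E. blinfun_apply (B e) x * w e)" for w :: "'a \<Rightarrow> real" and x
  define K where "K = (\<Sum>e\<in>E. norm (B e))"
  define N where "N w = c * K * (\<Sum>e\<in>E. \<bar>w e\<bar>)" for w :: "'a \<Rightarrow> real"
  have meas: "(\<lambda>w. w e) \<in> borel_measurable (std_gaussian E)" if "e \<in> E" for e
    using distributed_std_gaussian_component[OF that] by (simp add: distributed_def)
  have "random_functional (std_gaussian E) L N"
  proof (rule random_functional.intro)
    show "linear (L w)" for w
      by (rule linearI) (simp_all add: L_def blinfun.add_right blinfun.scaleR_right sum.distrib
          sum_distrib_left algebra_simps)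
    show "(\<lambda>w. L w x) \<in> borel_measurable (std_gaussian E)" for x
      unfolding L_def by (intro borel_measurable_times borel_measurable_sum meas) auto
    show "integrable (std_gaussian E) (\<lambda>w. N w ^ k)" for k
      unfolding N_def power_mult_distrib
      by (intro integrable_mult_right integrable_std_gaussian_l1_power E)
    fix w x
    have "\<bar>\<Sum>e\<in>E. blinfun_apply (B e) x * w e\<bar> \<le> (\<Sum>e\<in>E. \<bar>blinfun_apply (B e) x * w e\<bar>)"
      by (rule sum_abs)
    also have "\<dots> \<le> (\<Sum>e\<in>E. (K * norm x) * \<bar>w e\<bar>)"
    proof (rule sum_mono)
      fix e assume "e \<in> E"
      have "\<bar>blinfun_apply (B e) x\<bar> \<le> norm (B e) * norm x"
        using norm_blinfun[of "B e" x] by simp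
      also have "\<dots> \<le> K * norm x"
        unfolding K_def using E(1) \<open>e \<in> E\<close> by (intro mult_right_mono member_le_sum) auto
      finally show "\<bar>blinfun_apply (B e) x * w e\<bar> \<le> (K * norm x) * \<bar>w e\<bar>"
        unfolding abs_mult by (rule mult_right_mono) simp
    qed
    finally show "\<bar>L w x\<bar> \<le> N w * norm x"
      using c(1) by (simp add: L_def N_def abs_mult sum_distrib_left[symmetric] mult_ac)
  qed
  moreover have "op_norm B x ^ q = (\<integral>w. \<bar>L w x\<bar> ^ q \<partial>std_gaussian E)" for x
  proof -
    have "(\<integral>w. \<bar>L w x\<bar> ^ q \<partial>std_gaussian E)
        = c ^ q * (\<integral>w. \<bar>\<Sum>e\<in>E. blinfun_apply (B e) x * w e\<bar> ^ q \<partial>std_gaussian E)"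
      using c(1) by (simp add: L_def abs_mult power_mult_distrib)
    also have "\<dots> = op_norm B x ^ q"
      unfolding std_gaussian_linear_moment[OF E(1) assms(4)] c(2) op_norm_def E(2)[of x, symmetric]
      using \<open>0 < \<mu>\<close> by (simp add: \<mu>_def[symmetric])
    finally show ?thesis ..
  qed
  ultimately show thesis by (rule that)
qed

section \<open>The Lipschitz constant\<close>

lemma lip_const_1: "lip_const p 1 = fact (p + 1)"
proof -
  have "(\<Prod>i=1..p. 1 + real i) = fact (p + 1)"
    by (induction p) (simp_all add: algebra_simps)
  then show ?thesis by (simp add: lip_const_def)
qed

theorem theorem7p1:
  fixes B :: "'a::euclidean_space \<Rightarrow> 'a \<Rightarrow>\<^sub>L real" and p :: nat and f :: "'a \<Rightarrow> real"
  assumes "linear B" and "self_adjoint_op B" and "positive_definite_op B"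
  defines "f \<equiv> \<lambda>x. op_norm B x ^ (p + 1)"
  shows "lip_const p 1 = fact (p + 1) \<and>
    times_differentiable p f \<and>
    (\<forall>x\<^sub>1 x\<^sub>2. form_norm B p (\<lambda>hs. nth_derivative p f x\<^sub>2 hs - nth_derivative p f x\<^sub>1 hs)
       \<le> fact (p + 1) * op_norm B (x\<^sub>2 - x\<^sub>1))"
proof (intro conjI allI)
  obtain M :: "('a \<Rightarrow> real) measure" and L N where "random_functional M L N"
    and norm_eq: "\<And>x. op_norm B x ^ (p + 1) = (\<integral>w. \<bar>L w x\<bar> ^ (p + 1) \<partial>M)"
    using exists_random_functional[OF assms(1-3), of "p + 1"] by auto
  then interpret random_functional M L N by simp
  have f_eq: "f = (\<lambda>x. \<integral>w. \<bar>L w x\<bar> ^ (p + 1) \<partial>M)"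
    unfolding f_def norm_eq ..
  have f_unit: "f x = 1" if "op_norm B x = 1" for x
    using that by (simp add: f_def)
  have normalize: "op_norm B ((1 / op_norm B x) *\<^sub>R x) = 1" and norm_pos: "0 < op_norm B x"
    if "x \<noteq> 0" for x
  proof -
    have "0 < blinfun_apply (B x) x"
      using assms(3) that by (simp add: positive_definite_op_def)
    then show "0 < op_norm B x" and "op_norm B ((1 / op_norm B x) *\<^sub>R x) = 1"
      by (simp_all add: op_norm_def linear_scale[OF assms(1)] blinfun.scaleR_left
          blinfun.scaleR_right)
  qed
  show "lip_const p 1 = fact (p + 1)" by (rule lip_const_1)
  show "times_differentiable p f" unfolding f_eq by (rule times_differentiable_integral_power)
  \<comment> \<open>A unit vector \<open>e\<close> shows that the supremum in \<open>form_norm\<close> is over a nonempty set; it also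
    serves as the direction of \<open>y - x\<close> in case \<open>y = x\<close>.\<close>
  obtain b :: 'a where "b \<in> Basis" using nonempty_Basis by blast
  define e where "e = (1 / op_norm B b) *\<^sub>R b"
  have e: "op_norm B e = 1"
    using normalize \<open>b \<in> Basis\<close> nonzero_Basis unfolding e_def by blast
  fix x y :: 'a
  obtain u where u: "op_norm B u = 1" "y - x = op_norm B (y - x) *\<^sub>R u"
  proof (cases "y = x")
    case True
    then show thesis using that[of e] e by (simp add: op_norm_def)
  next
    case False
    then show thesis
      using that[of "(1 / op_norm B (y - x)) *\<^sub>R (y - x)"] normalize[of "y - x"]
        norm_pos[of "y - x"] by simp
  qed
  show "form_norm B p (\<lambda>hs. nth_derivative p f y hs - nth_derivative p f x hs)
      \<le> fact (p + 1) * op_norm B (y - x)"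
    unfolding form_norm_def
  proof (rule cSUP_least)
    have "replicate p e \<in> {hs. length hs = p \<and> (\<forall>h\<in>set hs. op_norm B h = 1)}"
      using e by simp
    then show "{hs. length hs = p \<and> (\<forall>h\<in>set hs. op_norm B h = 1)} \<noteq> {}" by blast
    fix hs assume "hs \<in> {hs. length hs = p \<and> (\<forall>h\<in>set hs. op_norm B h = 1)}"
    then have "\<bar>nth_derivative p f y hs - nth_derivative p f x hs\<bar>
        \<le> fact (p + 1) * \<bar>op_norm B (y - x)\<bar>"
      unfolding f_eq using u f_unit
      by (intro nth_derivative_integral_power_Lipschitz[of hs p u]) (auto simp: f_eq)
    moreover have "0 \<le> op_norm B (y - x)"
      using norm_pos[of "y - x"] by (cases "y = x") (auto simp: op_norm_def)
    ultimately show "\<bar>nth_derivative p f y hs - nth_derivative p f x hs\<bar>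
        \<le> fact (p + 1) * op_norm B (y - x)"
      by simp
  qed
qed

end
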